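(* For integers $a\ge 1$ and $m\ge 1$ let $\Omega^{m}_{a}=\{(n_1,\dots,n_a)\in\mathbb{N}_+^{a} : 1\le n_1\le\cdots\le n_a\le m\}$. For nonnegative integers $k_1,k_2,k_3$ with $k_1+k_2+k_3=n$ write $\binom{n}{k_1,\ k_2,\ k_3}=\frac{n!}{k_1!k_2!k_3!}$. For integers $a,b\ge1$ define \begin{align*} D_1&=\{(i,j)\in\mathbb{N}_+\times\mathbb{N}_+ : 1\le i\le b,\ a\le j,\ b-i+1\le j,\ j\le a+b-i\},\\ D_2&=\{(i,j)\in\mathbb{N}_+\times\mathbb{N}_+ : 1\le i\le b-1,\ a\le j,\ b-i\le j,\ j\le a+b-i-1\},\\ D_3&=\{(i,j)\in\mathbb{N}_+\times\mathbb{N}_+ : 1\le i\le a,\ a-i+1\le j,\ b\le j,\ j\le a+b-i\},\\ D_4&=\{(i,j)\in\mathbb{N}_+\times\mathbb{N}_+ : 1\le i\le a-1,\ a-i\le j,\ b\le j,\ j\le a+b-i-1\},\\ D_5&=\{j\in\mathbb{N} : a\le j,\ b\le j,\ j\le a+b-1\}, \end{align*} and \begin{align*} d_1(i,j)&=\binom{j-1}{i+j-b-1,\ j-a,\ a+b-i-j}(-1)^{a+b-i-j}, & d_2(i,j)&=\binom{j-1}{i+j-b,\ j-a,\ a+b-i-j-1}(-1)^{a+b-i-j},\\ d_3(i,j)&=\binom{j-1}{j-b,\ i+j-a-1,\ a+b-i-j}(-1)^{a+b-i-j}, & d_4(i,j)&=\binom{j-1}{j-b,\ i+j-a,\ a+b-i-j-1}(-1)^{a+b-i-j},\\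 d_5(j)&=\binom{j-1}{j-b,\ j-a,\ a+b-j-1}(-1)^{a+b-j}. \end{align*} Then for all integers $a,b\ge1$ and $m\ge 1$, \begin{align*} |\Omega^{m}_{a}|\,|\Omega^{m}_{b}|=&\sum_{(i,j)\in D_1}d_1(i,j)|\Omega^{m}_{i+j}|+\sum_{(i,j)\in D_2}d_2(i,j)|\Omega^{m}_{i+j}|+\sum_{(i,j)\in D_3}d_3(i,j)|\Omega^{m}_{i+j}|\\ &+\sum_{(i,j)\in D_4}d_4(i,j)|\Omega^{m}_{i+j}|+\sum_{j\in D_5}d_5(j)|\Omega^{m}_{j}|. \end{align*}
   Context: Here $d_k$ are the coefficients $c_k(a,b;\cdot)$ of the general Rota-Baxter identity evaluated at weight $\lambda=-1$. *)

theory Defs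
  imports Complex_Main
begin

definition Omega :: "nat \<Rightarrow> nat \<Rightarrow> nat list set" where
  "Omega m a = {ns. length ns = a \<and> sorted ns \<and> set ns \<subseteq> {1..m}}"

text \<open>Only meaningful for \<open>k\<^sub>1 + k\<^sub>2 + k\<^sub>3 = n\<close>, where the division is exact.\<close>

definition trinomial :: "nat \<Rightarrow> nat \<Rightarrow> nat \<Rightarrow> nat \<Rightarrow> nat" where
  "trinomial n k\<^sub>1 k\<^sub>2 k\<^sub>3 = fact n div (fact k\<^sub>1 * fact k\<^sub>2 * fact k\<^sub>3)"

text \<open>
  For \<open>a, b \<ge> 1\<close> none of the natural-number subtractions below truncates: in \<open>D1\<close>, ..., \<open>D5\<close> the
  bounds on \<open>i\<close> keep every difference nonnegative, and on the respective index set the arguments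
  of each trinomial coefficient are nonnegative and add up to \<open>j - 1\<close>.
\<close>

definition D1 :: "nat \<Rightarrow> nat \<Rightarrow> (nat \<times> nat) set" where
  "D1 a b = {(i, j). 1 \<le> i \<and> 1 \<le> j \<and> i \<le> b \<and> a \<le> j \<and> b - i + 1 \<le> j \<and> j \<le> a + b - i}"

definition D2 :: "nat \<Rightarrow> nat \<Rightarrow> (nat \<times> nat) set" where
  "D2 a b = {(i, j). 1 \<le> i \<and> 1 \<le> j \<and> i \<le> b - 1 \<and> a \<le> j \<and> b - i \<le> j \<and> j \<le> a + b - i - 1}"

definition D3 :: "nat \<Rightarrow> nat \<Rightarrow> (nat \<times> nat) set" where
  "D3 a b = {(i, j). 1 \<le> i \<and> 1 \<le> j \<and> i \<le> a \<and> a - i + 1 \<le> j \<and> b \<le> j \<and> j \<le> a + b - i}"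

definition D4 :: "nat \<Rightarrow> nat \<Rightarrow> (nat \<times> nat) set" where
  "D4 a b = {(i, j). 1 \<le> i \<and> 1 \<le> j \<and> i \<le> a - 1 \<and> a - i \<le> j \<and> b \<le> j \<and> j \<le> a + b - i - 1}"

definition D5 :: "nat \<Rightarrow> nat \<Rightarrow> nat set" where
  "D5 a b = {j. a \<le> j \<and> b \<le> j \<and> j \<le> a + b - 1}"

definition d1 :: "nat \<Rightarrow> nat \<Rightarrow> nat \<Rightarrow> nat \<Rightarrow> int" where
  "d1 a b i j =
     int (trinomial (j - 1) (i + j - b - 1) (j - a) (a + b - i - j)) * (- 1) ^ (a + b - i - j)"

definition d2 :: "nat \<Rightarrow> nat \<Rightarrow> nat \<Rightarrow> nat \<Rightarrow> int" where
  "d2 a b i j =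
     int (trinomial (j - 1) (i + j - b) (j - a) (a + b - i - j - 1)) * (- 1) ^ (a + b - i - j)"

definition d3 :: "nat \<Rightarrow> nat \<Rightarrow> nat \<Rightarrow> nat \<Rightarrow> int" where
  "d3 a b i j =
     int (trinomial (j - 1) (j - b) (i + j - a - 1) (a + b - i - j)) * (- 1) ^ (a + b - i - j)"

definition d4 :: "nat \<Rightarrow> nat \<Rightarrow> nat \<Rightarrow> nat \<Rightarrow> int" where
  "d4 a b i j =
     int (trinomial (j - 1) (j - b) (i + j - a) (a + b - i - j - 1)) * (- 1) ^ (a + b - i - j)"

definition d5 :: "nat \<Rightarrow> nat \<Rightarrow> nat \<Rightarrow> int" where
  "d5 a b j =
     int (trinomial (j - 1) (j - b) (j - a) (a + b - j - 1)) * (- 1) ^ (a + b - j)"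

end

theory Submission
  imports Defs
begin

text \<open>
  Let \<open>N s p q\<close> (\<open>path_coeff\<close> below) be the coefficient of \<open>x\<^sup>p y\<^sup>q\<close> in \<open>(x + y - x y)\<^sup>s\<close>, i.e. the number of lattice
  paths with \<open>s\<close> steps \<open>(1,0)\<close>, \<open>(0,1)\<close>, \<open>(1,1)\<close> and displacement \<open>(p, q)\<close>, each diagonal step
  carrying the sign \<open>-1\<close>. Since the generating function of \<open>k \<mapsto> |\<Omega>\<^sup>m\<^sub>k|\<close> is \<open>(1 - x)\<^sup>-\<^sup>m\<close> and
  \<open>(1 - x) (1 - y) = 1 - (x + y - x y)\<close>, we have \<open>|\<Omega>\<^sup>m\<^sub>a| |\<Omega>\<^sup>m\<^sub>b| = (\<Sum>k. N k a b |\<Omega>\<^sup>m\<^sub>k|)\<close>.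
  Split \<open>N k a b\<close> by the last step. The paths ending in \<open>(0,1)\<close>, classified by the length \<open>i\<close> of
  their final run of such steps and by the kind of step before that run, give the sums over
  \<open>D1\<close> and \<open>D2\<close>; those ending in \<open>(1,0)\<close> give \<open>D3\<close> and \<open>D4\<close>, those ending in \<open>(1,1)\<close> give \<open>D5\<close>.
\<close>

text \<open>Choose the \<open>p\<close> steps that move in the first coordinate, then the
  \<open>p + q - s\<close> diagonal ones among them. Without the guard, truncated subtraction would
  give \<open>s choose p\<close> for \<open>s > p + q\<close>.\<close>

definition path_coeff :: "nat \<Rightarrow> nat \<Rightarrow> nat \<Rightarrow> int" where
  "path_coeff s p q =
     (if s \<le> p + q then int ((s choose p) * (p choose (p + q - s))) * (- 1) ^ (p + q - s) else 0)"

lemma path_coeff_eq_0: "p + q < s \<Longrightarrow> path_coeff s p q = 0"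
  by (simp add: path_coeff_def)

lemma path_coeff_zero_Suc: "path_coeff 0 (Suc p) q = 0"
  by (simp add: path_coeff_def)

lemma path_coeff_0_left: "path_coeff s 0 q = (if s = q then 1 else 0)"
  by (cases s q rule: linorder_cases) (auto simp: path_coeff_def)

lemma path_coeff_0_right: "path_coeff s p 0 = (if s = p then 1 else 0)"
  by (cases s p rule: linorder_cases) (auto simp: path_coeff_def)

lemma path_coeff_Suc_Suc:
  "path_coeff (Suc s) (Suc p) (Suc q) =
     path_coeff s p (Suc q) + path_coeff s (Suc p) q - path_coeff s p q"
proof -
  \<comment> \<open>The diagonal term vanishes from \<open>s = Suc (p + q)\<close> on, the other two
    only one later; Pascal's rule does the rest.\<close>
  consider "s \<le> p + q" | "s = Suc (p + q)" | "s > Suc (p + q)" by linarith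
  then show ?thesis
  proof cases
    case 1
    then obtain t where t: "p + q = s + t"
      using le_Suc_ex by blast
    have "Suc p + Suc q - Suc s = Suc t" "p + Suc q - s = Suc t" "Suc p + q - s = Suc t"
      "p + q - s = t"
      using t by auto
    then show ?thesis
      using 1 t by (simp add: path_coeff_def algebra_simps)
  next
    case 2
    then show ?thesis
      by (simp add: path_coeff_def)
  next
    case 3
    then show ?thesis
      by (simp add: path_coeff_def)
  qed
qed

text \<open>Such a path has \<open>s - q\<close> steps (1,0), \<open>s - p\<close> steps (0,1) and
  \<open>p + q - s\<close> diagonal ones. This form shows the support and the symmetry in
  \<open>p\<close> and \<open>q\<close>.\<close>

lemma path_coeff_trinomial:
  "path_coeff s p q =
     (if p \<le> s \<and> q \<le> s \<and> s \<le> p + q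
      then int (trinomial s (s - q) (s - p) (p + q - s)) * (- 1) ^ (p + q - s) else 0)"
proof (cases "p \<le> s \<and> q \<le> s \<and> s \<le> p + q")
  case True
  define r where "r = p + q - s"
  have r: "r \<le> p" "p - r = s - q"
    using True by (auto simp: r_def)
  have "fact p * ((s choose p) * (p choose r) * (fact (s - q) * fact (s - p) * fact r))
      = (fact p * fact (s - p) * (s choose p)) * (fact r * fact (p - r) * (p choose r))"
    using r by (simp add: ac_simps)
  also have "\<dots> = fact p * fact s"
    using True r binomial_fact_lemma[of p s] binomial_fact_lemma[of r p] by simp
  finally have "(fact s :: nat) = (s choose p) * (p choose r) * (fact (s - q) * fact (s - p) * fact r)"
    by (metis fact_nonzero mult_left_cancel)
  then have "trinomial s (s - q) (s - p) r = (s choose p) * (p choose r)"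
    by (simp add: trinomial_def)
  then show ?thesis
    using True by (simp add: path_coeff_def r_def)
next
  case False
  then show ?thesis
    by (auto simp: path_coeff_def not_le)
qed

lemma trinomial_commute: "trinomial n k l r = trinomial n l k r"
  by (simp add: trinomial_def ac_simps)

lemma path_coeff_commute: "path_coeff s p q = path_coeff s q p"
  by (auto simp: path_coeff_trinomial trinomial_commute[of s "s - q"] add.commute)

section \<open>Recursion for the number of monotone tuples\<close>

lemma finite_Omega: "finite (Omega m a)"
  by (rule finite_subset[OF _ finite_lists_length_eq[of "{1..m}" a]]) (auto simp: Omega_def)

lemma card_Omega_0_right: "card (Omega m 0) = 1"
proof -
  have "Omega m 0 = {[]}" by (auto simp: Omega_def)
  then show ?thesis by simp
qed

lemma card_Omega_0_Suc: "card (Omega 0 (Suc a)) = 0"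
proof -
  have "Omega 0 (Suc a) = {}" by (auto simp: Omega_def)
  then show ?thesis by simp
qed

text \<open>Split by whether the last entry, the largest, is \<open>Suc m\<close>.\<close>

lemma card_Omega_Suc_Suc:
  "card (Omega (Suc m) (Suc a)) = card (Omega m (Suc a)) + card (Omega (Suc m) a)"
proof -
  let ?snoc = "\<lambda>ns. ns @ [Suc m]"
  have "Omega (Suc m) (Suc a) = Omega m (Suc a) \<union> ?snoc ` Omega (Suc m) a"
  proof (intro equalityI subsetI)
    fix xs assume xs: "xs \<in> Omega (Suc m) (Suc a)"
    then obtain ns n where eq: "xs = ns @ [n]"
      by (cases xs rule: rev_cases) (auto simp: Omega_def)
    show "xs \<in> Omega m (Suc a) \<union> ?snoc ` Omega (Suc m) a"
    proof (cases "n = Suc m")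
      case True
      then show ?thesis
        using xs eq by (auto simp: Omega_def sorted_append)
    next
      case False
      then have "xs \<in> Omega m (Suc a)"
        using xs eq by (fastforce simp: Omega_def sorted_append)
      then show ?thesis ..
    qed
  next
    fix xs assume "xs \<in> Omega m (Suc a) \<union> ?snoc ` Omega (Suc m) a"
    then show "xs \<in> Omega (Suc m) (Suc a)"
      by (fastforce simp: Omega_def sorted_append)
  qed
  moreover have "Omega m (Suc a) \<inter> ?snoc ` Omega (Suc m) a = {}"
    by (auto simp: Omega_def)
  moreover have "inj_on ?snoc (Omega (Suc m) a)"
    by (auto simp: inj_on_def)
  ultimately show ?thesis
    by (simp add: card_Un_disjoint finite_Omega card_image)
qed

section \<open>Product formula in terms of path coefficients\<close>

lemma sum_path_coeff_Suc_Suc: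
  "(\<Sum>k\<le>Suc K. path_coeff k (Suc a) (Suc b) * f k) =
     (\<Sum>k\<le>K. path_coeff k a (Suc b) * f (Suc k)) + (\<Sum>k\<le>K. path_coeff k (Suc a) b * f (Suc k))
     - (\<Sum>k\<le>K. path_coeff k a b * f (Suc k))"
  by (simp add: sum.atMost_Suc_shift path_coeff_zero_Suc path_coeff_Suc_Suc
      ring_distribs sum.distrib sum_subtractf del: sum.atMost_Suc)

text \<open>Any bound \<open>K \<ge> a + b\<close> is allowed so that the three smaller
  displacements in the inner induction, on \<open>a + b\<close>, can share one bound.\<close>

lemma card_Omega_mult:
  assumes "a + b \<le> K"
  shows "int (card (Omega m a)) * int (card (Omega m b)) =
    (\<Sum>k\<le>K. path_coeff k a b * int (card (Omega m k)))"
  using assms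
proof (induction m arbitrary: a b K)
  case 0
  show ?case
  proof (cases "a = 0 \<or> b = 0")
    case True
    then show ?thesis
      using 0 by (auto simp: path_coeff_0_left path_coeff_0_right card_Omega_0_right
            if_distrib[of "\<lambda>x. x * _"] cong: if_cong)
  next
    case False
    then obtain p q where "a = Suc p" "b = Suc q"
      by (meson not0_implies_Suc)
    moreover have "path_coeff k (Suc p) (Suc q) * int (card (Omega 0 k)) = 0" for k
      by (cases k) (simp_all add: path_coeff_zero_Suc card_Omega_0_Suc)
    ultimately show ?thesis
      by (simp only: card_Omega_0_Suc sum.neutral_const)
  qed
next
  case (Suc m)
  define T where "T n k = int (card (Omega n k))" for n k
  have T_Suc: "T (Suc m) (Suc k) = T m (Suc k) + T (Suc m) k" for k
    by (simp add: T_def card_Omega_Suc_Suc)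
  have T_diff: "T (Suc m) (Suc k) - T m (Suc k) = T (Suc m) k" for k
    by (simp add: T_Suc)
  have T_0: "T n 0 = 1" for n
    by (simp add: T_def card_Omega_0_right)
  have IH: "T m a * T m b = (\<Sum>k\<le>K. path_coeff k a b * T m k)" if "a + b \<le> K" for a b K
    using Suc.IH[OF that] by (simp add: T_def)
  have "T (Suc m) a * T (Suc m) b = (\<Sum>k\<le>K. path_coeff k a b * T (Suc m) k)" if "a + b \<le> K"
    for a b K
    using that
  proof (induction "a + b" arbitrary: a b K rule: less_induct)
    case less
    show ?case
    proof (cases "a = 0 \<or> b = 0")
      case True
      then show ?thesis
        using less.prems
        by (auto simp: path_coeff_0_left path_coeff_0_right T_0
            if_distrib[of "\<lambda>x. x * _"] cong: if_cong)
    next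
      case False
      then obtain p q L where eqs: "a = Suc p" "b = Suc q" "K = Suc L"
        using less.prems by (metis add_is_0 le_zero_eq not0_implies_Suc)
      then have le: "p + Suc q \<le> L" "Suc p + q \<le> L" "p + q \<le> L"
        using less.prems by auto
      \<comment> \<open>The outer hypothesis covers level \<open>m\<close>. In the difference of
        levels, \<open>T_diff\<close> lowers the index just as the path recursion raises it, leaving
        three products for the inner hypothesis.\<close>
      have "(\<Sum>k\<le>K. path_coeff k a b * T (Suc m) k) =
          (\<Sum>k\<le>K. path_coeff k a b * T m k)
          + (\<Sum>k\<le>Suc L. path_coeff k (Suc p) (Suc q) * (T (Suc m) k - T m k))"
        by (simp add: eqs sum.distrib[symmetric] algebra_simps del: sum.atMost_Suc)
      also have "(\<Sum>k\<le>Suc L. path_coeff k (Suc p) (Suc q) * (T (Suc m) k - T m k)) =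
          T (Suc m) p * T (Suc m) (Suc q) + T (Suc m) (Suc p) * T (Suc m) q
          - T (Suc m) p * T (Suc m) q"
        unfolding sum_path_coeff_Suc_Suc using le eqs
        by (simp add: less.hyps[of _ _ L] T_diff)
      also have "(\<Sum>k\<le>K. path_coeff k a b * T m k) = T m a * T m b"
        using IH[OF less.prems] ..
      also have "\<dots> + (T (Suc m) p * T (Suc m) (Suc q) + T (Suc m) (Suc p) * T (Suc m) q
          - T (Suc m) p * T (Suc m) q) = T (Suc m) a * T (Suc m) b"
        by (simp add: eqs T_Suc algebra_simps)
      finally show ?thesis ..
    qed
  qed
  then show ?case
    using Suc.prems by (simp add: T_def)
qed

text \<open>
  The paths of displacement \<open>(Suc p, q)\<close> sorted by the length \<open>i\<close> of their final run of steps
  \<open>(0,1)\<close>; the step before that run is \<open>(1,0)\<close> in the first sum and \<open>(1,1)\<close> in the second.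
\<close>

lemma sum_path_coeff_final_run:
  assumes "p + q \<le> K"
  shows "(\<Sum>i\<le>q. \<Sum>j\<le>K. path_coeff j p (q - i) * f (Suc (i + j)))
       - (\<Sum>i<q. \<Sum>j\<le>K. path_coeff j p (q - Suc i) * f (Suc (i + j)))
       = (\<Sum>k\<le>Suc K. path_coeff k (Suc p) q * f k)"
  using assms
proof (induction q arbitrary: f)
  case 0
  then show ?case
    by (simp add: sum.atMost_Suc_shift path_coeff_zero_Suc path_coeff_0_right del: sum.atMost_Suc)
next
  case (Suc q)
  \<comment> \<open>Removing one step (0,1) shortens the run and shifts \<open>f\<close>; the
    \<open>i = 0\<close> terms are the paths not ending in (0,1).\<close>
  have "(\<Sum>k\<le>K. path_coeff k (Suc p) q * f (Suc k)) =
      (\<Sum>k\<le>Suc K. path_coeff k (Suc p) q * f (Suc k))"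
    using Suc.prems by (simp add: path_coeff_eq_0)
  also have "\<dots> = (\<Sum>i\<le>q. \<Sum>j\<le>K. path_coeff j p (q - i) * f (Suc (Suc (i + j))))
       - (\<Sum>i<q. \<Sum>j\<le>K. path_coeff j p (q - Suc i) * f (Suc (Suc (i + j))))"
    using Suc.IH[of "\<lambda>k. f (Suc k)"] Suc.prems by simp
  finally show ?case
    by (simp add: sum_path_coeff_Suc_Suc sum.atMost_Suc_shift[of _ q] sum.lessThan_Suc_shift
        del: sum.atMost_Suc sum.lessThan_Suc)
qed

section \<open>Matching the five sums with the last steps\<close>

lemma D1_eq_image:
  "D1 (Suc p) (Suc q) = (\<lambda>(i, j). (Suc i, Suc j)) `
     {(i, j). i \<le> q \<and> p \<le> j \<and> q - i \<le> j \<and> i + j \<le> p + q}" (is "_ = ?R")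
proof -
  have "(i, j) \<in> D1 (Suc p) (Suc q) \<longleftrightarrow> (i, j) \<in> ?R" for i j
    by (cases i; cases j) (auto simp: D1_def image_iff)
  then show ?thesis
    by (metis (no_types, lifting) set_eqI surj_pair)
qed

text \<open>Before the run of length \<open>Suc i\<close> and the step (1,0) there are
  \<open>j\<close> steps of displacement \<open>(p, q - i)\<close>; the index set is exactly the
  support of their coefficient.\<close>

lemma sum_D1:
  "(\<Sum>(i, j)\<in>D1 (Suc p) (Suc q). d1 (Suc p) (Suc q) i j * f (i + j)) =
     (\<Sum>i\<le>q. \<Sum>j\<le>p + q. path_coeff j p (q - i) * f (Suc (Suc (i + j))))"
proof -
  let ?S = "{(i, j). i \<le> q \<and> p \<le> j \<and> q - i \<le> j \<and> i + j \<le> p + q}"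
  have "(\<Sum>(i, j)\<in>D1 (Suc p) (Suc q). d1 (Suc p) (Suc q) i j * f (i + j)) =
      (\<Sum>(i, j)\<in>?S. path_coeff j p (q - i) * f (Suc (Suc (i + j))))"
    unfolding D1_eq_image
    by (subst sum.reindex)
      (auto simp: inj_on_def d1_def path_coeff_trinomial add.commute Suc_diff_le intro!: sum.cong)
  also have "\<dots> = (\<Sum>(i, j)\<in>{..q} \<times> {..p + q}. path_coeff j p (q - i) * f (Suc (Suc (i + j))))"
    by (rule sum.mono_neutral_left) (auto simp: path_coeff_trinomial split: if_splits)
  finally show ?thesis
    by (simp add: sum.cartesian_product)
qed

lemma D2_eq_image:
  "D2 (Suc p) (Suc q) = (\<lambda>(i, j). (Suc i, Suc j)) `
     {(i, j). i < q \<and> p \<le> j \<and> q - Suc i \<le> j \<and> Suc (i + j) \<le> p + q}" (is "_ = ?R")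
proof -
  have "(i, j) \<in> D2 (Suc p) (Suc q) \<longleftrightarrow> (i, j) \<in> ?R" for i j
    by (cases i; cases j) (auto simp: D2_def image_iff)
  then show ?thesis
    by (metis (no_types, lifting) set_eqI surj_pair)
qed

lemma sum_D2:
  "(\<Sum>(i, j)\<in>D2 (Suc p) (Suc q). d2 (Suc p) (Suc q) i j * f (i + j)) =
     - (\<Sum>i<q. \<Sum>j\<le>p + q. path_coeff j p (q - Suc i) * f (Suc (Suc (i + j))))"
proof -
  let ?S = "{(i, j). i < q \<and> p \<le> j \<and> q - Suc i \<le> j \<and> Suc (i + j) \<le> p + q}"
  \<comment> \<open>The minus sign belongs to the diagonal step before the run.\<close>
  have coeff: "d2 (Suc p) (Suc q) (Suc i) (Suc j) = - path_coeff j p (q - Suc i)"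
    if "i < q" "p \<le> j" "q - Suc i \<le> j" "Suc (i + j) \<le> p + q" for i j
  proof -
    have "Suc p + Suc q - Suc i - Suc j = Suc (p + (q - Suc i) - j)" "j \<le> p + (q - Suc i)"
      "Suc i + Suc j - Suc q = j - (q - Suc i)"
      using that by auto
    then show ?thesis
      using that by (simp add: d2_def path_coeff_trinomial)
  qed
  have "(\<Sum>(i, j)\<in>D2 (Suc p) (Suc q). d2 (Suc p) (Suc q) i j * f (i + j)) =
      (\<Sum>(i, j)\<in>?S. - (path_coeff j p (q - Suc i) * f (Suc (Suc (i + j)))))"
    unfolding D2_eq_image
    by (subst sum.reindex) (auto simp: inj_on_def coeff intro!: sum.cong)
  also have "\<dots> = (\<Sum>(i, j)\<in>{..<q} \<times> {..p + q}.
      - (path_coeff j p (q - Suc i) * f (Suc (Suc (i + j)))))"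
    by (rule sum.mono_neutral_left) (auto simp: path_coeff_trinomial split: if_splits)
  finally show ?thesis
    by (simp add: sum.cartesian_product[symmetric] sum_negf)
qed

lemma sum_D1_D2:
  "(\<Sum>(i, j)\<in>D1 (Suc p) (Suc q). d1 (Suc p) (Suc q) i j * f (i + j))
     + (\<Sum>(i, j)\<in>D2 (Suc p) (Suc q). d2 (Suc p) (Suc q) i j * f (i + j))
     = (\<Sum>k\<le>Suc (p + q). path_coeff k (Suc p) q * f (Suc k))"
  using sum_path_coeff_final_run[of p q "p + q" "\<lambda>k. f (Suc k)"]
  by (simp add: sum_D1 sum_D2 del: sum.atMost_Suc)

text \<open>Swapping the coordinates reduces \<open>D3\<close> and \<open>D4\<close> to
  \<open>D1\<close> and \<open>D2\<close>.\<close>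

lemma D3_eq: "D3 a b = D1 b a"
  by (auto simp: D1_def D3_def add.commute)

lemma D4_eq: "D4 a b = D2 b a"
  by (auto simp: D2_def D4_def add.commute)

lemma d3_eq: "d3 a b i j = d1 b a i j"
  unfolding d1_def d3_def trinomial_commute[of "j - 1" "j - b"] add.commute[of b a] ..

lemma d4_eq: "d4 a b i j = d2 b a i j"
  unfolding d2_def d4_def trinomial_commute[of "j - 1" "j - b"] add.commute[of b a] ..

lemma sum_D5:
  "(\<Sum>j\<in>D5 (Suc p) (Suc q). d5 (Suc p) (Suc q) j * f j) =
     - (\<Sum>k\<le>Suc (p + q). path_coeff k p q * f (Suc k))"
proof -
  let ?S = "{k. p \<le> k \<and> q \<le> k \<and> k \<le> p + q}"
  have "(\<Sum>j\<in>D5 (Suc p) (Suc q). d5 (Suc p) (Suc q) j * f j) =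
      (\<Sum>k\<in>?S. - (path_coeff k p q * f (Suc k)))"
    by (rule sum.reindex_bij_witness[where i = Suc and j = "\<lambda>j. j - 1"])
      (auto simp: D5_def d5_def path_coeff_trinomial Suc_diff_le)
  also have "\<dots> = (\<Sum>k\<le>Suc (p + q). - (path_coeff k p q * f (Suc k)))"
    by (rule sum.mono_neutral_left) (auto simp: path_coeff_trinomial split: if_splits)
  finally show ?thesis
    by (simp add: sum_negf del: sum.atMost_Suc)
qed

theorem theorem4:
  fixes a b m :: nat
  assumes "a \<ge> 1" and "b \<ge> 1" and "m \<ge> 1"
  shows "int (card (Omega m a)) * int (card (Omega m b)) =
      (\<Sum>(i, j)\<in>D1 a b. d1 a b i j * int (card (Omega m (i + j))))
    + (\<Sum>(i, j)\<in>D2 a b. d2 a b i j * int (card (Omega m (i + j))))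
    + (\<Sum>(i, j)\<in>D3 a b. d3 a b i j * int (card (Omega m (i + j))))
    + (\<Sum>(i, j)\<in>D4 a b. d4 a b i j * int (card (Omega m (i + j))))
    + (\<Sum>j\<in>D5 a b. d5 a b j * int (card (Omega m j)))"
proof -
  define T where "T k = int (card (Omega m k))" for k
  obtain p q where eqs: "a = Suc p" "b = Suc q"
    using assms by (metis One_nat_def Suc_le_D)
  have "T a * T b = (\<Sum>k\<le>Suc (Suc (p + q)). path_coeff k (Suc p) (Suc q) * T k)"
    using card_Omega_mult[of a b "Suc (Suc (p + q))" m] by (simp add: T_def eqs del: sum.atMost_Suc)
  also have "\<dots> = (\<Sum>k\<le>Suc (p + q). path_coeff k (Suc p) q * T (Suc k))
      + (\<Sum>k\<le>Suc (q + p). path_coeff k (Suc q) p * T (Suc k))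
      - (\<Sum>k\<le>Suc (p + q). path_coeff k p q * T (Suc k))"
    by (simp add: sum_path_coeff_Suc_Suc path_coeff_commute[of _ p "Suc q"] add.commute[of q p]
        del: sum.atMost_Suc)
  also have "\<dots> = (\<Sum>(i, j)\<in>D1 a b. d1 a b i j * T (i + j))
      + (\<Sum>(i, j)\<in>D2 a b. d2 a b i j * T (i + j))
      + (\<Sum>(i, j)\<in>D3 a b. d3 a b i j * T (i + j)) + (\<Sum>(i, j)\<in>D4 a b. d4 a b i j * T (i + j))
      + (\<Sum>j\<in>D5 a b. d5 a b j * T j)"
    unfolding eqs D3_eq D4_eq d3_eq d4_eq sum_D5 sum_D1_D2[symmetric] by simp
  finally show ?thesis
    by (simp add: T_def)
qed

end
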